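(* Let $X$ be an infinite set and let $S$ be a semigroup (under composition of relations) such that $\mathsf{FSym}(X)\subset S\subset\mathsf{FRel}(X)$. Then (1) $S$ is perfectly supportable; (2) $S$ is $\sigma$-discrete in its semi-Zariski topology $\mathfrak Z_s$; (3) $S$ is $\sigma$-discrete in each Hausdorff shift-invariant topology on $S$.
   Context: For a set $X$, $\mathsf{Rel}(X)=2^{X\times X}$ is the semigroup of all relations $f\subset X\times X$ with the operation $f\circ g=\{(x,z)\in X\times X:\exists y\in X\ (x,y)\in f,\ (y,z)\in g\}$. For a relation $f$ put $f^{-1}=\{(y,x):(x,y)\in f\}$ and $f(x)=\{y\in X:(x,y)\in f\}$ for $x\in X$. The support of $f\in\mathsf{Rel}(X)$ is $\mathsf{supt}(f)=\{x\in X: f(x)\ne\{x\}\text{ or }f^{-1}(x)\ne\{x\}\}$. $\mathsf{FRel}(X)=\{f\in\mathsf{Rel}(X):\mathsf{supt}(f)\text{ is finite}\}$, a subsemigroup of $\mathsf{Rel}(X)$. Each function $f:X\to X$ is identified with the relation $\{(x,f(x)):x\in X\}$. $\mathsf{FSym}(X)$ is the group of bijections $f:X\to X$ with $\{x\in X:f(x)\ne x\}$ finite, regarded as a subset of $\mathsf{FRel}(X)$. A $\mathsf{supt}$-semigroup is a pair $(S,\mathsf{supt})$ consisting of a semigroup $S$ and a function $\mathsf{supt}:S\to 2^X$ into the power set of some set $X$ such that for all $f,g\in S$: (1) $\mathsf{supt}(fg)\subset\mathsf{supt}(f)\cup\mathsf{supt}(g)$, and (2) $fg=gf$ whenever $\mathsf{supt}(f)\cap\mathsf{supt}(g)=\emptyset$.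 The set $\mathsf{supt}(S)=\bigcup_{a\in S}\mathsf{supt}(a)\subset X$ is called the support of $S$. For $F\subset X$ put $S(F)=\{f\in S:\mathsf{supt}(f)\subset F\}$. A $\mathsf{supt}$-semigroup $(S,\mathsf{supt})$ with support $X=\mathsf{supt}(S)$ is $\mathsf{supt}$-finitary if each $f\in S$ has finite support $\mathsf{supt}(f)$ and for each finite $F\subset X$ the set $S(F)$ is finite. It is $\mathsf{supt}$-perfect if it is $\mathsf{supt}$-finitary and $S(F)=\mathsf C(S(X\setminus F))$ for every finite $F\subset X$, where for $T\subset S$ the centralizer is $\mathsf C(T)=\{g\in S: fg=gf \text{ for all } f\in T\}$. A semigroup $S$ is perfectly supportable if for some set $X$ and some function $\mathsf{supt}:S\to 2^X$ the pair $(S,\mathsf{supt})$ is a $\mathsf{supt}$-perfect semigroup. The semi-Zariski topology $\mathfrak Z_s$ on a semigroup $S$ is the topology generated by the sub-base consisting of the sets $\{x\in S:axb\ne c\}$ and $\{x\in S:axb\ne cxd\}$, where $a,b,c,d\in S^1$ and $S^1=S\cup\{1\}$ is $S$ with an attached external unit $1\notin S$ (so $1x=x1=x$ for all $x\in S^1$). A topology on a semigroup $S$ is shift-invariant if for every $a\in S$ the shifts $x\mapsto ax$ and $x\mapsto xa$ are continuous maps $S\to S$. A topological space is $\sigma$-discrete if it can be written as a countable union of discrete subspaces. *)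

theory Defs
  imports "HOL-Analysis.Analysis"
begin

section \<open>Semigroups on a carrier\<close>

definition semigroup_on :: "'s set \<Rightarrow> ('s \<Rightarrow> 's \<Rightarrow> 's) \<Rightarrow> bool" where
  "semigroup_on S m \<longleftrightarrow>
     (\<forall>a\<in>S. \<forall>b\<in>S. m a b \<in> S) \<and>
     (\<forall>a\<in>S. \<forall>b\<in>S. \<forall>c\<in>S. m (m a b) c = m a (m b c))"

definition centralizer_on :: "'s set \<Rightarrow> ('s \<Rightarrow> 's \<Rightarrow> 's) \<Rightarrow> 's set \<Rightarrow> 's set" where
  "centralizer_on S m T = {g \<in> S. \<forall>f\<in>T. m f g = m g f}"


section \<open>Semigroups with a support function\<close>

definition supt_semigroup ::
  "'s set \<Rightarrow> ('s \<Rightarrow> 's \<Rightarrow> 's) \<Rightarrow> 'x set \<Rightarrow> ('s \<Rightarrow> 'x set) \<Rightarrow> bool" where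
  "supt_semigroup S m X supt \<longleftrightarrow>
     semigroup_on S m \<and>
     (\<forall>f\<in>S. supt f \<subseteq> X) \<and>
     (\<forall>f\<in>S. \<forall>g\<in>S. supt (m f g) \<subseteq> supt f \<union> supt g) \<and>
     (\<forall>f\<in>S. \<forall>g\<in>S. supt f \<inter> supt g = {} \<longrightarrow> m f g = m g f)"

definition total_supt :: "'s set \<Rightarrow> ('s \<Rightarrow> 'x set) \<Rightarrow> 'x set" where
  "total_supt S supt = (\<Union>a\<in>S. supt a)"

definition supported_in :: "'s set \<Rightarrow> ('s \<Rightarrow> 'x set) \<Rightarrow> 'x set \<Rightarrow> 's set" where
  "supported_in S supt F = {f \<in> S. supt f \<subseteq> F}"

text \<open>In the next two definitions the finite sets range over subsets of the total support of
  the semigroup, and complements are taken in that total support (not in a larger codomain).\<close>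

definition supt_finitary :: "'s set \<Rightarrow> ('s \<Rightarrow> 'x set) \<Rightarrow> bool" where
  "supt_finitary S supt \<longleftrightarrow>
     (\<forall>f\<in>S. finite (supt f)) \<and>
     (\<forall>F. F \<subseteq> total_supt S supt \<and> finite F \<longrightarrow> finite (supported_in S supt F))"

definition supt_perfect :: "'s set \<Rightarrow> ('s \<Rightarrow> 's \<Rightarrow> 's) \<Rightarrow> ('s \<Rightarrow> 'x set) \<Rightarrow> bool" where
  "supt_perfect S m supt \<longleftrightarrow>
     supt_finitary S supt \<and>
     (\<forall>F. F \<subseteq> total_supt S supt \<and> finite F \<longrightarrow>
        supported_in S supt F =
          centralizer_on S m (supported_in S supt (total_supt S supt - F)))"

text \<open>HOL cannot quantify over types inside a formula, so the type from which the set
  \<open>X\<close> is taken is a parameter.\<close>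

definition perfectly_supportable ::
  "'x itself \<Rightarrow> 's set \<Rightarrow> ('s \<Rightarrow> 's \<Rightarrow> 's) \<Rightarrow> bool" where
  "perfectly_supportable (_ :: 'x itself) S m \<longleftrightarrow>
     (\<exists>(X :: 'x set) (supt :: 's \<Rightarrow> 'x set).
        supt_semigroup S m X supt \<and> supt_perfect S m supt)"


section \<open>Topologies on a semigroup\<close>

text \<open>\<open>None\<close> is the external unit, attached even when the semigroup already has a unit.\<close>

fun unit_ext_mult :: "('s \<Rightarrow> 's \<Rightarrow> 's) \<Rightarrow> 's option \<Rightarrow> 's option \<Rightarrow> 's option" where
  "unit_ext_mult m None y = y"
| "unit_ext_mult m (Some x) None = Some x"
| "unit_ext_mult m (Some x) (Some y) = Some (m x y)"

definition unit_ext :: "'s set \<Rightarrow> 's option set" where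
  "unit_ext S = insert None (Some ` S)"

text \<open>The first family contains \<open>S\<close> itself (take \<open>c\<close> to be the external unit),
  so the generated topology has \<open>S\<close> as its underlying set.\<close>

definition semi_zariski :: "'s set \<Rightarrow> ('s \<Rightarrow> 's \<Rightarrow> 's) \<Rightarrow> 's topology" where
  "semi_zariski S m =
     (let mul = unit_ext_mult m; S1 = unit_ext S in
      topology_generated_by
        ({{x \<in> S. mul (mul a (Some x)) b \<noteq> c} | a b c. a \<in> S1 \<and> b \<in> S1 \<and> c \<in> S1} \<union>
         {{x \<in> S. mul (mul a (Some x)) b \<noteq> mul (mul c (Some x)) d} | a b c d.
            a \<in> S1 \<and> b \<in> S1 \<and> c \<in> S1 \<and> d \<in> S1}))"

lemma topspace_semi_zariski: "topspace (semi_zariski S m) = S"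
proof
  show "topspace (semi_zariski S m) \<subseteq> S"
    by (auto simp: semi_zariski_def Let_def)
  have "S = {x \<in> S. unit_ext_mult m (unit_ext_mult m None (Some x)) None \<noteq> None}"
    by auto
  moreover have "None \<in> unit_ext S"
    by (simp add: unit_ext_def)
  ultimately show "S \<subseteq> topspace (semi_zariski S m)"
    unfolding semi_zariski_def Let_def topology_generated_by_topspace by blast
qed

definition shift_invariant :: "'s set \<Rightarrow> ('s \<Rightarrow> 's \<Rightarrow> 's) \<Rightarrow> 's topology \<Rightarrow> bool" where
  "shift_invariant S m T \<longleftrightarrow>
     topspace T = S \<and>
     (\<forall>a\<in>S. continuous_map T T (\<lambda>x. m a x) \<and> continuous_map T T (\<lambda>x. m x a))"

definition sigma_discrete :: "'s topology \<Rightarrow> bool" where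
  "sigma_discrete T \<longleftrightarrow>
     (\<exists>\<A>. countable \<A> \<and> \<Union>\<A> = topspace T \<and>
        (\<forall>A\<in>\<A>. subtopology T A = discrete_topology A))"


section \<open>Finitely supported relations\<close>

definition rel_supt :: "'a set \<Rightarrow> 'a rel \<Rightarrow> 'a set" where
  "rel_supt X f = {x \<in> X. f `` {x} \<noteq> {x} \<or> f\<inverse> `` {x} \<noteq> {x}}"

definition FRel :: "'a set \<Rightarrow> 'a rel set" where
  "FRel X = {f. f \<subseteq> X \<times> X \<and> finite (rel_supt X f)}"

definition FSym :: "'a set \<Rightarrow> 'a rel set" where
  "FSym X = {{(x, f x) | x. x \<in> X} | f. bij_betw f X X \<and> finite {x \<in> X. f x \<noteq> x}}"

end

theory Submission
  imports Defs
begin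

text \<open>A relation \<open>f\<close> fixing a point \<open>y\<close> and commuting with the transposition of \<open>x\<close> and \<open>y\<close> also
  fixes \<open>x\<close>. Hence centralizers of transpositions control supports, which gives perfectness.
  It also gives \<open>\<sigma>\<close>-discreteness of the semi-Zariski topology, the pieces being the sets of
  elements with exactly \<open>n\<close> points in the support. If \<open>F\<close> is the support of such an \<open>f\<close>, and \<open>Y\<close> is a
  set of \<open>n + 1\<close> points outside \<open>F\<close>, then the elements commuting with no transposition of a point of
  \<open>F\<close> and a point of \<open>Y\<close> form an open neighbourhood of \<open>f\<close>. Every such element \<open>g\<close> with \<open>n\<close> points
  in its support is supported exactly by \<open>F\<close>: some point of \<open>Y\<close> is fixed by \<open>g\<close>, so no point of \<open>F\<close>
  is. There are only finitely many such \<open>g\<close>, and singletons are closed. Finally, every Hausdorff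
  shift-invariant topology refines the semi-Zariski one.\<close>

section \<open>Supports of relations\<close>

lemma not_in_rel_supt_iff:
  assumes "x \<in> X"
  shows "x \<notin> rel_supt X f \<longleftrightarrow> (\<forall>u. (x, u) \<in> f \<longleftrightarrow> u = x) \<and> (\<forall>u. (u, x) \<in> f \<longleftrightarrow> u = x)"
  using assms by (auto simp: rel_supt_def Image_def set_eq_iff)

lemma rel_supt_subset: "rel_supt X f \<subseteq> X"
  by (auto simp: rel_supt_def)

lemma rel_supt_relcomp: "rel_supt X (f O g) \<subseteq> rel_supt X f \<union> rel_supt X g"
proof
  fix x assume x: "x \<in> rel_supt X (f O g)"
  then have X: "x \<in> X"
    by (rule subsetD[OF rel_supt_subset])
  show "x \<in> rel_supt X f \<union> rel_supt X g"
  proof (rule ccontr)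
    assume "x \<notin> rel_supt X f \<union> rel_supt X g"
    with X have "x \<notin> rel_supt X (f O g)"
      by (simp add: not_in_rel_supt_iff relcomp_unfold)
    with x show False
      by simp
  qed
qed

text \<open>On a path from \<open>x\<close> by \<open>f\<close> to \<open>y\<close> and by
  \<open>g\<close> to \<open>z\<close>, the middle point avoids one of the two supports, so one of
  the two steps is trivial. Disjointness then makes that relation fix the far end of the other step
  as well, and the steps can be interchanged. One inclusion suffices, since the hypotheses are
  symmetric in \<open>f\<close> and \<open>g\<close>.\<close>

lemma relcomp_subset_commute:
  assumes "f \<subseteq> X \<times> X" "g \<subseteq> X \<times> X" and disj: "rel_supt X f \<inter> rel_supt X g = {}"
  shows "f O g \<subseteq> g O f"
proof clarify
  fix x y z assume xy: "(x, y) \<in> f" and yz: "(y, z) \<in> g"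
  then have X: "x \<in> X" "y \<in> X" "z \<in> X"
    using assms by auto
  show "(x, z) \<in> g O f"
  proof (cases "y \<in> rel_supt X f")
    case True
    with disj have "y \<notin> rel_supt X g" by blast
    with yz X have "z = y" by (simp add: not_in_rel_supt_iff)
    \<comment> \<open>Otherwise \<open>f\<close> would fix \<open>x\<close>, so the
      \<open>f\<close>-step would be trivial and \<open>y = x\<close> would lie outside the support
      of \<open>f\<close>.\<close>
    moreover have "x \<notin> rel_supt X g"
    proof
      assume "x \<in> rel_supt X g"
      with disj have "x \<notin> rel_supt X f" by blast
      with xy X have "y = x" by (simp add: not_in_rel_supt_iff)
      with True \<open>x \<notin> rel_supt X f\<close> show False by simp
    qed
    ultimately show ?thesis
      using xy X by (auto simp: not_in_rel_supt_iff)
  next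
    case False
    with xy X have "x = y" by (simp add: not_in_rel_supt_iff)
    moreover have "z \<notin> rel_supt X f"
    proof
      assume z: "z \<in> rel_supt X f"
      with disj have "z \<notin> rel_supt X g" by blast
      with yz X have "y = z" by (simp add: not_in_rel_supt_iff)
      with False z show False by simp
    qed
    ultimately show ?thesis
      using yz X by (auto simp: not_in_rel_supt_iff)
  qed
qed

lemma relcomp_commute:
  assumes "f \<subseteq> X \<times> X" "g \<subseteq> X \<times> X" "rel_supt X f \<inter> rel_supt X g = {}"
  shows "f O g = g O f"
  using relcomp_subset_commute[of f X g] relcomp_subset_commute[of g X f] assms
  by (simp add: Int_commute subset_antisym)

text \<open>Off \<open>F\<close> such a relation is the identity, so it is determined by its trace
  on \<open>F \<times> F\<close>.\<close>

lemma finite_relations_supported_in: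
  assumes "finite F"
  shows "finite {f. f \<subseteq> X \<times> X \<and> rel_supt X f \<subseteq> F}"
proof (rule finite_subset)
  show "{f. f \<subseteq> X \<times> X \<and> rel_supt X f \<subseteq> F} \<subseteq> (\<lambda>h. h \<union> Id_on (X - F)) ` Pow (F \<times> F)"
  proof clarify
    fix f assume f: "f \<subseteq> X \<times> X" "rel_supt X f \<subseteq> F"
    have fixed: "(\<forall>u. (x, u) \<in> f \<longleftrightarrow> u = x) \<and> (\<forall>u. (u, x) \<in> f \<longleftrightarrow> u = x)" if "x \<in> X - F" for x
      using that f(2) not_in_rel_supt_iff[of x X f] by blast
    have "f = (f \<inter> F \<times> F) \<union> Id_on (X - F)"
    proof (intro subset_antisym subrelI)
      fix x y assume xy: "(x, y) \<in> f"
      then have "x \<in> X" "y \<in> X"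
        using f(1) by auto
      then show "(x, y) \<in> (f \<inter> F \<times> F) \<union> Id_on (X - F)"
        using xy fixed[of x] fixed[of y] by (cases "x \<in> F"; cases "y \<in> F") (simp_all add: Id_on_iff)
    next
      fix x y assume "(x, y) \<in> (f \<inter> F \<times> F) \<union> Id_on (X - F)"
      then show "(x, y) \<in> f"
        using fixed[of x] by (auto simp: Id_on_iff)
    qed
    then show "f \<in> (\<lambda>h. h \<union> Id_on (X - F)) ` Pow (F \<times> F)"
      by (rule image_eqI) simp
  qed
  show "finite ((\<lambda>h. h \<union> Id_on (X - F)) ` Pow (F \<times> F))"
    using assms by simp
qed

section \<open>Transpositions as relations\<close>

text \<open>\<open>Transposition.transpose\<close> acts on the whole type; its graph is cut down to
  \<open>X\<close> to match the shape of the elements of \<open>FSym X\<close>.\<close>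

definition swap_rel :: "'a set \<Rightarrow> 'a \<Rightarrow> 'a \<Rightarrow> 'a rel" where
  "swap_rel X x y = {(z, Transposition.transpose x y z) | z. z \<in> X}"

lemma mem_swap_rel_iff:
  "(u, v) \<in> swap_rel X x y \<longleftrightarrow> u \<in> X \<and> v = Transposition.transpose x y u"
  by (auto simp: swap_rel_def)

lemma swap_rel_in_FSym:
  assumes "x \<in> X" "y \<in> X"
  shows "swap_rel X x y \<in> FSym X"
proof -
  have "bij_betw (Transposition.transpose x y) X X"
    using assms by (intro permutes_imp_bij permutes_swap_id)
  moreover have "finite {z \<in> X. Transposition.transpose x y z \<noteq> z}"
    by (rule finite_subset[of _ "{x, y}"]) (auto simp: Transposition.transpose_def)
  ultimately show ?thesis
    unfolding FSym_def swap_rel_def by blast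
qed

lemma rel_supt_swap_rel:
  assumes "x \<in> X" "y \<in> X" "x \<noteq> y"
  shows "rel_supt X (swap_rel X x y) = {x, y}"
proof (rule subset_antisym)
  let ?t = "swap_rel X x y"
  show "rel_supt X ?t \<subseteq> {x, y}"
  proof
    fix z assume z: "z \<in> rel_supt X ?t"
    then have X: "z \<in> X"
      by (rule subsetD[OF rel_supt_subset])
    show "z \<in> {x, y}"
    proof (rule ccontr)
      assume "z \<notin> {x, y}"
      then have "Transposition.transpose x y u = z \<longleftrightarrow> u = z" for u
        by (auto simp: Transposition.transpose_def)
      then have "z \<notin> rel_supt X ?t"
        using X \<open>z \<notin> {x, y}\<close> by (auto simp: not_in_rel_supt_iff mem_swap_rel_iff)
      with z show False
        by simp
    qed
  qed
  have t: "(x, y) \<in> ?t"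
    using assms by (simp add: mem_swap_rel_iff)
  have "x \<in> rel_supt X ?t"
    using t assms(3) not_in_rel_supt_iff[OF assms(1)] by metis
  moreover have "y \<in> rel_supt X ?t"
    using t assms(3) not_in_rel_supt_iff[OF assms(2)] by metis
  ultimately show "{x, y} \<subseteq> rel_supt X ?t"
    by simp
qed

text \<open>A transposition is an involution, so commuting with it makes \<open>f\<close> invariant
  under a conjugation that carries \<open>y\<close> to \<open>x\<close>. Being fixed is transported
  along with the point.\<close>

lemma commute_swap_rel_imp_fixed:
  assumes f: "f \<subseteq> X \<times> X" and xy: "x \<in> X" "y \<in> X" "y \<notin> rel_supt X f"
    and comm: "f O swap_rel X x y = swap_rel X x y O f"
  shows "x \<notin> rel_supt X f"
proof -
  let ?t = "swap_rel X x y"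
  have fy: "(y, u) \<in> f \<longleftrightarrow> u = y" "(u, y) \<in> f \<longleftrightarrow> u = y" for u
    using xy by (simp_all add: not_in_rel_supt_iff)
  have t: "(x, y) \<in> ?t" "(y, x) \<in> ?t"
    using xy by (simp_all add: mem_swap_rel_iff)
  have "u = x" if "(x, u) \<in> f" for u
  proof -
    \<comment> \<open>\<open>y\<close> reaches \<open>u\<close> through \<open>x\<close>. In the
      other order the first step starts at \<open>y\<close>, which \<open>f\<close> fixes, so
      \<open>u\<close> is the image of \<open>y\<close> under the transposition.\<close>
    have "(y, u) \<in> f O ?t"
      using that t comm by blast
    then show ?thesis
      using fy by (auto simp: mem_swap_rel_iff)
  qed
  moreover have "u = x" if "(u, x) \<in> f" for u
  proof -
    have "(u, y) \<in> ?t O f"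
      using that t comm by blast
    then show ?thesis
      using fy by (auto simp: mem_swap_rel_iff Transposition.transpose_eq_iff)
  qed
  moreover have "(x, x) \<in> f"
  proof -
    have "(x, y) \<in> f O ?t"
      using fy t comm by blast
    then show ?thesis
      by (auto simp: mem_swap_rel_iff Transposition.transpose_def split: if_splits)
  qed
  ultimately show ?thesis
    using xy not_in_rel_supt_iff[of x X f] by blast
qed

section \<open>Perfect supportability\<close>

text \<open>Perfectness takes complements in the total support. Each point of \<open>X\<close> lies
  in the support of a transposition, because an infinite \<open>X\<close> has a second point to swap
  it with.\<close>

lemma total_supt_rel_supt:
  assumes "infinite X" "FSym X \<subseteq> S"
  shows "total_supt S (rel_supt X) = X"
proof
  show "total_supt S (rel_supt X) \<subseteq> X"
    unfolding total_supt_def by (rule UN_least) (rule rel_supt_subset)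
  show "X \<subseteq> total_supt S (rel_supt X)"
  proof
    fix x assume x: "x \<in> X"
    have "infinite (X - {x})"
      using assms(1) by simp
    then have "X - {x} \<noteq> {}"
      by (rule infinite_imp_nonempty)
    then obtain y where y: "y \<in> X" "x \<noteq> y"
      by blast
    show "x \<in> total_supt S (rel_supt X)"
      unfolding total_supt_def
    proof (rule UN_I)
      show "swap_rel X x y \<in> S"
        using swap_rel_in_FSym[OF x y(1)] assms(2) by (rule subsetD[rotated])
      show "x \<in> rel_supt X (swap_rel X x y)"
        using rel_supt_swap_rel[OF x y] by simp
    qed
  qed
qed

lemma supt_semigroup_rel_supt:
  assumes "semigroup_on S (O)" "S \<subseteq> FRel X"
  shows "supt_semigroup S (O) X (rel_supt X)"
proof -
  have "f O g = g O f" if "f \<in> S" "g \<in> S" "rel_supt X f \<inter> rel_supt X g = {}" for f g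
    using that assms(2) by (intro relcomp_commute[of f X g]) (auto simp: FRel_def)
  then show ?thesis
    unfolding supt_semigroup_def
    by (intro conjI ballI impI assms(1) rel_supt_subset rel_supt_relcomp)
qed

lemma finite_supported_in_rel_supt:
  assumes "S \<subseteq> FRel X" "finite F"
  shows "finite (supported_in S (rel_supt X) F)"
  by (rule finite_subset[OF _ finite_relations_supported_in[OF assms(2), of X]])
     (use assms(1) in \<open>auto simp: supported_in_def FRel_def\<close>)

lemma centralizer_supported_in_compl:
  assumes "infinite X" "FSym X \<subseteq> S" "S \<subseteq> FRel X" "F \<subseteq> X" "finite F"
  shows "centralizer_on S (O) (supported_in S (rel_supt X) (X - F))
           = supported_in S (rel_supt X) F"
proof
  show "centralizer_on S (O) (supported_in S (rel_supt X) (X - F))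
          \<subseteq> supported_in S (rel_supt X) F"
  proof
    fix g assume g: "g \<in> centralizer_on S (O) (supported_in S (rel_supt X) (X - F))"
    then have gS: "g \<in> S" and comm: "\<And>f. f \<in> S \<Longrightarrow> rel_supt X f \<subseteq> X - F \<Longrightarrow> f O g = g O f"
      by (auto simp: centralizer_on_def supported_in_def)
    then have gX: "g \<subseteq> X \<times> X" and fin: "finite (rel_supt X g)"
      using assms(3) by (auto simp: FRel_def)
    have "x \<notin> rel_supt X g" if x: "x \<in> X" "x \<notin> F" for x
    proof -
      \<comment> \<open>The partner \<open>y\<close> avoids \<open>F\<close> so that the
        transposition is supported in \<open>X - F\<close> and hence commutes with \<open>g\<close>.
        It avoids the support of \<open>g\<close> so that fixedness passes from \<open>y\<close> to
        \<open>x\<close>.\<close>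
      have "infinite (X - (F \<union> rel_supt X g \<union> {x}))"
        using assms(1,5) fin by (intro Diff_infinite_finite) auto
      then have "X - (F \<union> rel_supt X g \<union> {x}) \<noteq> {}"
        by (rule infinite_imp_nonempty)
      then obtain y where y: "y \<in> X" "y \<notin> F" "y \<notin> rel_supt X g" "x \<noteq> y"
        by blast
      have "swap_rel X x y O g = g O swap_rel X x y"
        using x y swap_rel_in_FSym[of x X y] assms(2)
        by (intro comm) (auto simp: rel_supt_swap_rel)
      then show ?thesis
        using commute_swap_rel_imp_fixed[OF gX x(1) y(1,3)] by simp
    qed
    then show "g \<in> supported_in S (rel_supt X) F"
      using gS rel_supt_subset by (fastforce simp: supported_in_def)
  qed
  show "supported_in S (rel_supt X) F
          \<subseteq> centralizer_on S (O) (supported_in S (rel_supt X) (X - F))"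
  proof
    fix g assume g: "g \<in> supported_in S (rel_supt X) F"
    have "f O g = g O f" if "f \<in> supported_in S (rel_supt X) (X - F)" for f
      using that g assms(3) by (intro relcomp_commute[of _ X]) (auto simp: supported_in_def FRel_def)
    with g show "g \<in> centralizer_on S (O) (supported_in S (rel_supt X) (X - F))"
      by (auto simp: centralizer_on_def supported_in_def)
  qed
qed

lemma supt_perfect_rel_supt:
  assumes "infinite X" "FSym X \<subseteq> S" "S \<subseteq> FRel X"
  shows "supt_perfect S (O) (rel_supt X)"
proof -
  have "finite (rel_supt X f)" if "f \<in> S" for f
    using that assms(3) by (auto simp: FRel_def)
  then show ?thesis
    using assms centralizer_supported_in_compl[OF assms] finite_supported_in_rel_supt[OF assms(3)]
    by (simp add: supt_perfect_def supt_finitary_def total_supt_rel_supt)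
qed

section \<open>Topologies on semigroups\<close>

lemma openin_semi_zariski_neq:
  assumes "c \<in> S"
  shows "openin (semi_zariski S m) {x \<in> S. x \<noteq> c}"
proof -
  \<comment> \<open>Sub-basic of the first kind, with the external unit on both sides.\<close>
  have "{x \<in> S. x \<noteq> c}
          = {x \<in> S. unit_ext_mult m (unit_ext_mult m None (Some x)) None \<noteq> Some c}"
    by auto
  moreover have "None \<in> unit_ext S" "Some c \<in> unit_ext S"
    using assms by (auto simp: unit_ext_def)
  ultimately show ?thesis
    unfolding semi_zariski_def Let_def by (intro topology_generated_by_Basis) blast
qed

lemma openin_semi_zariski_noncommuting:
  assumes "t \<in> S"
  shows "openin (semi_zariski S m) {x \<in> S. m x t \<noteq> m t x}"
proof -
  \<comment> \<open>Sub-basic of the second kind, comparing \<open>1 x t\<close> with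
    \<open>t x 1\<close>.\<close>
  have "{x \<in> S. m x t \<noteq> m t x}
          = {x \<in> S. unit_ext_mult m (unit_ext_mult m None (Some x)) (Some t)
                      \<noteq> unit_ext_mult m (unit_ext_mult m (Some t) (Some x)) None}"
    by auto
  moreover have "None \<in> unit_ext S" "Some t \<in> unit_ext S"
    using assms by (auto simp: unit_ext_def)
  ultimately show ?thesis
    unfolding semi_zariski_def Let_def by (intro topology_generated_by_Basis) blast
qed

lemma openin_finite_Ball:
  assumes "finite I" "\<And>i. i \<in> I \<Longrightarrow> openin T {x \<in> topspace T. P i x}"
  shows "openin T {x \<in> topspace T. \<forall>i\<in>I. P i x}"
  using assms
proof (induction I rule: finite_induct)
  case (insert i I)
  then have "openin T ({x \<in> topspace T. P i x} \<inter> {x \<in> topspace T. \<forall>i\<in>I. P i x})"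
    by (intro openin_Int) auto
  then show ?case
    by (rule back_subst) auto
qed simp

lemma discrete_subtopology_if_isolated:
  assumes "A \<subseteq> topspace T" "\<And>f. f \<in> A \<Longrightarrow> \<exists>U. openin T U \<and> U \<inter> A = {f}"
  shows "subtopology T A = discrete_topology A"
proof -
  have "openin (subtopology T A) {f}" if "f \<in> A" for f
    using assms(2)[OF that] by (metis openin_subtopology)
  then show ?thesis
    using assms(1) by (metis discrete_topology_unique topspace_subtopology_subset)
qed

lemma sigma_discrete_finer:
  assumes "sigma_discrete T" "topspace T' = topspace T" "\<And>U. openin T U \<Longrightarrow> openin T' U"
  shows "sigma_discrete T'"
proof -
  obtain \<A> where \<A>: "countable \<A>" "\<Union>\<A> = topspace T"
    "\<And>A. A \<in> \<A> \<Longrightarrow> subtopology T A = discrete_topology A"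
    using assms(1) by (auto simp: sigma_discrete_def)
  have "subtopology T' A = discrete_topology A" if "A \<in> \<A>" for A
  proof (rule discrete_subtopology_if_isolated)
    show "A \<subseteq> topspace T'"
      using that \<A>(2) assms(2) by blast
    fix f assume "f \<in> A"
    then have "openin (subtopology T A) {f}"
      using \<A>(3)[OF that] by simp
    then show "\<exists>U. openin T' U \<and> U \<inter> A = {f}"
      using assms(3) by (metis openin_subtopology)
  qed
  then show ?thesis
    using \<A>(1,2) assms(2) unfolding sigma_discrete_def by (intro exI[of _ \<A>]) simp
qed

lemma openin_Hausdorff_neq:
  assumes "Hausdorff_space T'" "continuous_map T T' f" "continuous_map T T' g"
  shows "openin T {x \<in> topspace T. f x \<noteq> g x}"
proof -
  have "{x \<in> topspace T. f x \<noteq> g x} = topspace T - {x \<in> topspace T. f x = g x}"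
    by auto
  then show ?thesis
    using closedin_continuous_maps_eq[OF assms] by (simp add: closedin_def)
qed

text \<open>A product with a factor \<open>Some x\<close> is never the external unit, so the
  two-sided shift descends from the extended semigroup to a genuine self-map. This absorbs the case
  distinction on \<open>None\<close>.\<close>

lemma shift_invariant_two_sided_shift:
  assumes "shift_invariant S m T" "a \<in> unit_ext S" "b \<in> unit_ext S"
  obtains h where "continuous_map T T h"
    "\<And>x. unit_ext_mult m (unit_ext_mult m a (Some x)) b = Some (h x)"
proof -
  have left: "continuous_map T T (\<lambda>x. m s x)" and right: "continuous_map T T (\<lambda>x. m x s)"
    if "s \<in> S" for s
    using assms(1) that by (auto simp: shift_invariant_def)
  have "\<exists>h. continuous_map T T h \<and> (\<forall>x. unit_ext_mult m a (Some x) = Some (h x))"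
  proof (cases a)
    case None
    then show ?thesis
      by (intro exI[of _ "\<lambda>x. x"]) simp
  next
    case (Some s)
    then show ?thesis
      using assms(2) left by (intro exI[of _ "m s"]) (auto simp: unit_ext_def)
  qed
  then obtain h1 where
    h1: "continuous_map T T h1" "\<And>x. unit_ext_mult m a (Some x) = Some (h1 x)"
    by blast
  have "\<exists>h. continuous_map T T h \<and> (\<forall>x. unit_ext_mult m (Some x) b = Some (h x))"
  proof (cases b)
    case None
    then show ?thesis
      by (intro exI[of _ "\<lambda>x. x"]) simp
  next
    case (Some s)
    then show ?thesis
      using assms(3) right by (intro exI[of _ "\<lambda>x. m x s"]) (auto simp: unit_ext_def)
  qed
  then obtain h2 where
    h2: "continuous_map T T h2" "\<And>x. unit_ext_mult m (Some x) b = Some (h2 x)"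
    by blast
  show thesis
    using that[of "h2 \<circ> h1"] continuous_map_compose[OF h1(1) h2(1)] h1(2) h2(2) by simp
qed

text \<open>It is enough to treat the sub-base. Each of its sets is all of \<open>S\<close> or the
  set where two continuous maps, shifts or constants, into a Hausdorff space differ.\<close>

lemma openin_Hausdorff_shift_invariant_if_semi_zariski:
  assumes "Hausdorff_space T" "shift_invariant S m T" "openin (semi_zariski S m) U"
  shows "openin T U"
proof -
  have S: "topspace T = S"
    using assms(2) by (simp add: shift_invariant_def)
  note shift = shift_invariant_two_sided_shift[OF assms(2)]
  have const: "openin T {x \<in> S. unit_ext_mult m (unit_ext_mult m a (Some x)) b \<noteq> c}"
    if abc: "a \<in> unit_ext S" "b \<in> unit_ext S" "c \<in> unit_ext S" for a b c
  proof -
    obtain h where h: "continuous_map T T h"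
      "\<And>x. unit_ext_mult m (unit_ext_mult m a (Some x)) b = Some (h x)"
      by (rule shift[OF abc(1,2)]) (rule that)
    show ?thesis
    proof (cases c)
      case None
      then show ?thesis
        using h(2) S openin_topspace[of T] by simp
    next
      case (Some s)
      with abc(3) S have "continuous_map T T (\<lambda>_. s)"
        by (auto simp: unit_ext_def)
      from openin_Hausdorff_neq[OF assms(1) h(1) this] show ?thesis
        using Some h(2) S by simp
    qed
  qed
  have shifts: "openin T {x \<in> S. unit_ext_mult m (unit_ext_mult m a (Some x)) b
                                   \<noteq> unit_ext_mult m (unit_ext_mult m c (Some x)) d}"
    if abcd: "a \<in> unit_ext S" "b \<in> unit_ext S" "c \<in> unit_ext S" "d \<in> unit_ext S" for a b c d
  proof -
    obtain h where h: "continuous_map T T h"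
      "\<And>x. unit_ext_mult m (unit_ext_mult m a (Some x)) b = Some (h x)"
      by (rule shift[OF abcd(1,2)]) (rule that)
    obtain k where k: "continuous_map T T k"
      "\<And>x. unit_ext_mult m (unit_ext_mult m c (Some x)) d = Some (k x)"
      by (rule shift[OF abcd(3,4)]) (rule that)
    from openin_Hausdorff_neq[OF assms(1) h(1) k(1)] show ?thesis
      using h(2) k(2) S by simp
  qed
  have gen: "generate_topology_on
        ({{x \<in> S. unit_ext_mult m (unit_ext_mult m a (Some x)) b \<noteq> c} | a b c.
            a \<in> unit_ext S \<and> b \<in> unit_ext S \<and> c \<in> unit_ext S} \<union>
         {{x \<in> S. unit_ext_mult m (unit_ext_mult m a (Some x)) b
                    \<noteq> unit_ext_mult m (unit_ext_mult m c (Some x)) d} | a b c d.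
            a \<in> unit_ext S \<and> b \<in> unit_ext S \<and> c \<in> unit_ext S \<and> d \<in> unit_ext S}) U"
    using assms(3) unfolding semi_zariski_def Let_def by (rule openin_topology_generated_by)
  show ?thesis
    by (rule generate_topology_on_coarsest[OF istopology_openin _ gen], elim UnE CollectE exE conjE)
       (simp_all only: const shifts)
qed

section \<open>Discreteness\<close>

lemma isolated_in_equal_supt_card:
  assumes "infinite X" "FSym X \<subseteq> S" "S \<subseteq> FRel X" "f \<in> S"
  shows "\<exists>U. openin (semi_zariski S (O)) U
           \<and> U \<inter> {g \<in> S. card (rel_supt X g) = card (rel_supt X f)} = {f}"
proof -
  let ?F = "rel_supt X f"
  let ?Z = "semi_zariski S (O)"
  have rel: "g \<subseteq> X \<times> X" and fin: "finite (rel_supt X g)" if "g \<in> S" for g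
    using that assms(3) by (auto simp: FRel_def)
  have "infinite (X - ?F)"
    using assms(1) fin[OF assms(4)] by (rule Diff_infinite_finite[rotated])
  then obtain Y where Y: "Y \<subseteq> X - ?F" "finite Y" "card Y = Suc (card ?F)"
    using infinite_arbitrarily_large by blast
  have t: "swap_rel X x y \<in> S" if "x \<in> ?F" "y \<in> Y" for x y
    using that Y(1) rel_supt_subset[of X f] swap_rel_in_FSym[of x X y] assms(2) by blast
  define N where "N = {g \<in> S. \<forall>p\<in>?F \<times> Y.
    g O swap_rel X (fst p) (snd p) \<noteq> swap_rel X (fst p) (snd p) O g}"
  \<comment> \<open>\<open>N\<close> will force equal supports; \<open>V\<close> then discards the
    finitely many competitors of \<open>f\<close> supported in \<open>?F\<close>.\<close>
  define V where "V = {g \<in> S. \<forall>h\<in>supported_in S (rel_supt X) ?F - {f}. g \<noteq> h}"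
  have "openin ?Z N"
    unfolding N_def
  proof (rule openin_finite_Ball[where T = ?Z, unfolded topspace_semi_zariski])
    show "finite (?F \<times> Y)"
      using fin[OF assms(4)] Y(2) by simp
  qed (use t openin_semi_zariski_noncommuting in fastforce)
  moreover have "openin ?Z V"
    unfolding V_def
  proof (rule openin_finite_Ball[where T = ?Z, unfolded topspace_semi_zariski])
    show "finite (supported_in S (rel_supt X) ?F - {f})"
      using finite_supported_in_rel_supt[OF assms(3) fin[OF assms(4)]] by simp
  qed (auto simp: supported_in_def intro: openin_semi_zariski_neq)
  ultimately have "openin ?Z (N \<inter> V)"
    by (rule openin_Int)
  moreover have "N \<inter> V \<inter> {g \<in> S. card (rel_supt X g) = card ?F} = {f}"
  proof
    have "f \<in> N"
    proof -
      have "f O swap_rel X x y \<noteq> swap_rel X x y O f" if xy: "x \<in> ?F" "y \<in> Y" for x y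
      proof -
        have "x \<in> X" "y \<in> X" "y \<notin> ?F"
          using xy Y(1) rel_supt_subset[of X f] by blast+
        with commute_swap_rel_imp_fixed[OF rel[OF assms(4)]] xy(1) show ?thesis
          by blast
      qed
      then show ?thesis
        using assms(4) by (simp add: N_def)
    qed
    then show "{f} \<subseteq> N \<inter> V \<inter> {g \<in> S. card (rel_supt X g) = card ?F}"
      using assms(4) by (auto simp: V_def)
    show "N \<inter> V \<inter> {g \<in> S. card (rel_supt X g) = card ?F} \<subseteq> {f}"
    proof
      fix g assume g: "g \<in> N \<inter> V \<inter> {g \<in> S. card (rel_supt X g) = card ?F}"
      then have gS: "g \<in> S" and card: "card (rel_supt X g) = card ?F"
        and V: "g \<in> supported_in S (rel_supt X) ?F \<Longrightarrow> g = f"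
        and N: "\<And>x y. x \<in> ?F \<Longrightarrow> y \<in> Y \<Longrightarrow>
                  g O swap_rel X x y \<noteq> swap_rel X x y O g"
        by (auto simp: N_def V_def)
      \<comment> \<open>The extra point in \<open>Y\<close> matters here: \<open>Y\<close> is too
        large to fit into the support of \<open>g\<close>.\<close>
      have "\<not> Y \<subseteq> rel_supt X g"
        using card_mono[OF fin[OF gS], of Y] Y(3) card by auto
      then obtain y where y: "y \<in> Y" "y \<notin> rel_supt X g"
        by blast
      have "x \<in> rel_supt X g" if x: "x \<in> ?F" for x
      proof (rule ccontr)
        assume nx: "x \<notin> rel_supt X g"
        have X: "x \<in> X" "y \<in> X" "x \<noteq> y"
          using x y(1) Y(1) rel_supt_subset[of X f] by blast+
        have "swap_rel X x y \<subseteq> X \<times> X"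
          using rel t x y(1) by blast
        moreover have "rel_supt X g \<inter> rel_supt X (swap_rel X x y) = {}"
          using X nx y(2) by (simp add: rel_supt_swap_rel)
        \<comment> \<open>With \<open>x\<close> and \<open>y\<close> both fixed by \<open>g\<close>,
          disjoint supports make \<open>g\<close> commute with their transposition, which membership
          in \<open>N\<close> forbids.\<close>
        ultimately show False
          using relcomp_commute[OF rel[OF gS]] N[OF x y(1)] by blast
      qed
      then have "rel_supt X g = ?F"
        using card card_subset_eq[OF fin[OF gS], of ?F] by auto
      then show "g \<in> {f}"
        using V gS by (simp add: supported_in_def)
    qed
  qed
  ultimately show ?thesis
    by blast
qed

lemma sigma_discrete_semi_zariski:
  assumes "infinite X" "FSym X \<subseteq> S" "S \<subseteq> FRel X"
  shows "sigma_discrete (semi_zariski S (O))"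
proof -
  define A where "A n = {g \<in> S. card (rel_supt X g) = n}" for n
  have "subtopology (semi_zariski S (O)) (A n) = discrete_topology (A n)" for n
  proof (rule discrete_subtopology_if_isolated)
    show "A n \<subseteq> topspace (semi_zariski S (O))"
      by (auto simp: A_def topspace_semi_zariski)
    fix f assume "f \<in> A n"
    then show "\<exists>U. openin (semi_zariski S (O)) U \<and> U \<inter> A n = {f}"
      using isolated_in_equal_supt_card[OF assms, of f] by (auto simp: A_def)
  qed
  moreover have "\<Union> (range A) = topspace (semi_zariski S (O))"
    by (auto simp: A_def topspace_semi_zariski)
  ultimately show ?thesis
    unfolding sigma_discrete_def by (intro exI[of _ "range A"]) auto
qed

theorem theorem4p5:
  fixes X :: "'a set" and S :: "'a rel set"
  assumes "infinite X"
    and "semigroup_on S (O)"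
    and "FSym X \<subseteq> S" and "S \<subseteq> FRel X"
  shows "perfectly_supportable TYPE('a) S (O) \<and>
         sigma_discrete (semi_zariski S (O)) \<and>
         (\<forall>T. Hausdorff_space T \<and> shift_invariant S (O) T \<longrightarrow> sigma_discrete T)"
proof (intro conjI allI impI)
  show "perfectly_supportable TYPE('a) S (O)"
    using supt_semigroup_rel_supt[OF assms(2,4)] supt_perfect_rel_supt[OF assms(1,3,4)]
    unfolding perfectly_supportable_def by blast
  show Z: "sigma_discrete (semi_zariski S (O))"
    using assms(1,3,4) by (rule sigma_discrete_semi_zariski)
  fix T assume T: "Hausdorff_space T \<and> shift_invariant S (O) T"
  show "sigma_discrete T"
  proof (rule sigma_discrete_finer[OF Z])
    show "topspace T = topspace (semi_zariski S (O))"
      using T by (simp add: shift_invariant_def topspace_semi_zariski)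
  qed (use T openin_Hausdorff_shift_invariant_if_semi_zariski in blast)
qed

end
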